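(* Let $n\ge 1$ be an integer. Under the convention that a matrix $\boldsymbol{S}\in\mathbb{C}^{2n\times 2n}$ is symplectic when $\boldsymbol{S}^H\boldsymbol{J}\boldsymbol{S}=\boldsymbol{J}$, it is not the case that every complex Hermitian positive-definite matrix $\boldsymbol{M}\in\mathbb{C}^{2n\times 2n}$ admits a Williamson-type factorization of the form $$\boldsymbol{M}=\boldsymbol{S}^H\begin{bmatrix}\boldsymbol{\Lambda}&\boldsymbol{0}\\\boldsymbol{0}&\boldsymbol{\Lambda}\end{bmatrix}\boldsymbol{S},\qquad \boldsymbol{\Lambda}=\operatorname{diag}(\lambda_1,\dots,\lambda_n),\quad \lambda_j>0,$$ with $\boldsymbol{S}\in\mathbb{C}^{2n\times 2n}$ symplectic in this sense.
   Context: Here $\boldsymbol{J}=\begin{bmatrix}\boldsymbol{0}&\boldsymbol{I}_n\\-\boldsymbol{I}_n&\boldsymbol{0}\end{bmatrix}\in\mathbb{R}^{2n\times 2n}$ is the standard symplectic unit matrix, $\boldsymbol{I}_n$ is the $n\times n$ identity matrix, and $(\cdot)^H$ denotes the conjugate transpose. *)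

theory Defs
  imports Complex_Main "Jordan_Normal_Form.Schur_Decomposition"
begin

definition symplectic_unit :: "nat \<Rightarrow> complex mat" where
  "symplectic_unit n = four_block_mat (0\<^sub>m n n) (1\<^sub>m n) (- 1\<^sub>m n) (0\<^sub>m n n)"

definition symplectic_mat :: "nat \<Rightarrow> complex mat \<Rightarrow> bool" where
  "symplectic_mat n S \<longleftrightarrow>
     S \<in> carrier_mat (2 * n) (2 * n) \<and>
     mat_adjoint S * symplectic_unit n * S = symplectic_unit n"

definition hermitian_mat :: "complex mat \<Rightarrow> bool" where
  "hermitian_mat A \<longleftrightarrow> mat_adjoint A = A"

(* Since v \<bullet>c w conjugates its second argument, (A *\<^sub>v v) \<bullet>c v is v^H A v.
   The order on complex numbers is that of HOL-Library.Complex_Order: 0 < z means that z is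
   real and positive. *)
definition hermitian_positive_definite :: "nat \<Rightarrow> complex mat \<Rightarrow> bool" where
  "hermitian_positive_definite k A \<longleftrightarrow>
     A \<in> carrier_mat k k \<and> hermitian_mat A \<and>
     (\<forall>v \<in> carrier_vec k. v \<noteq> 0\<^sub>v k \<longrightarrow> 0 < (A *\<^sub>v v) \<bullet>c v)"

(* The diagonal entries are real, and indexed from 0 to n - 1. *)
definition williamson_diag :: "nat \<Rightarrow> (nat \<Rightarrow> real) \<Rightarrow> complex mat" where
  "williamson_diag n l =
     (let L = mat_diag n (\<lambda>i. complex_of_real (l i))
      in four_block_mat L (0\<^sub>m n n) (0\<^sub>m n n) L)"

end

theory Submission
  imports Defs
begin

text \<open>If \<open>M = S\<^sup>H D S\<close> with \<open>S\<close> symplectic, then \<open>S J S\<^sup>H = J\<close>, so cyclicity of the trace gives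
  \<open>tr (J M) = tr (J D) = 0\<close>. The matrix \<open>A = I + 2 \<i> J\<close> is Hermitian and invertible because
  \<open>(I - 2 \<i> J) A = -3 I\<close>. Hence \<open>M = A\<^sup>2 = 5 I + 4 \<i> J\<close> is positive definite, but
  \<open>tr (J M) = -8 \<i> n\<close>.\<close>

definition mtrace :: "'a :: comm_monoid_add mat \<Rightarrow> 'a" where
  "mtrace A = (\<Sum>i<dim_row A. A $$ (i, i))"

lemma mtrace_mult_commute:
  fixes A B :: "'a :: comm_semiring_0 mat"
  assumes "A \<in> carrier_mat m k" "B \<in> carrier_mat k m"
  shows "mtrace (A * B) = mtrace (B * A)"
proof -
  have "mtrace (A * B) = (\<Sum>i<m. \<Sum>j<k. A $$ (i, j) * B $$ (j, i))"
    using assms by (auto simp: mtrace_def scalar_prod_def atLeast0LessThan intro!: sum.cong)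
  also have "\<dots> = (\<Sum>j<k. \<Sum>i<m. B $$ (j, i) * A $$ (i, j))"
    by (subst sum.swap) (simp add: mult.commute)
  also have "\<dots> = mtrace (B * A)"
    using assms by (auto simp: mtrace_def scalar_prod_def atLeast0LessThan intro!: sum.cong)
  finally show ?thesis .
qed

text \<open>\<open>four_block_mat\<close> takes its size from the corner blocks \<open>A\<close> and
  \<open>D\<close>. Both are square, so the diagonal runs through their diagonals and never enters
  \<open>B\<close> or \<open>C\<close>.\<close>

lemma mtrace_four_block:
  fixes A B C D :: "'a :: comm_monoid_add mat"
  assumes "A \<in> carrier_mat n n" "D \<in> carrier_mat m m"
  shows "mtrace (four_block_mat A B C D) = mtrace A + mtrace D"
proof -
  have "mtrace (four_block_mat A B C D) =
      (\<Sum>i<n + m. if i < n then A $$ (i, i) else D $$ (i - n, i - n))"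
    using assms by (auto simp: mtrace_def intro!: sum.cong)
  also have "\<dots> = (\<Sum>i<n. A $$ (i, i)) + (\<Sum>i=n..<n + m. D $$ (i - n, i - n))"
    by (subst atLeast0LessThan[symmetric], subst sum.atLeastLessThan_concat[of 0 n "n + m", symmetric])
      (auto simp: atLeast0LessThan)
  also have "(\<Sum>i=n..<n + m. D $$ (i - n, i - n)) = (\<Sum>i<m. D $$ (i, i))"
    using sum.shift_bounds_nat_ivl[of "\<lambda>i. D $$ (i - n, i - n)" 0 n m]
    by (simp add: atLeast0LessThan add.commute)
  finally show ?thesis using assms by (simp add: mtrace_def)
qed

lemma index_mat_adjoint [simp]:
  assumes "i < dim_col A" "j < dim_row A"
  shows "mat_adjoint A $$ (i, j) = conjugate (A $$ (j, i))"
  using assms by (simp add: mat_adjoint_def mat_of_rows_def)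

lemma dim_mat_adjoint [simp]:
  "dim_row (mat_adjoint A) = dim_col A" "dim_col (mat_adjoint A) = dim_row A"
  by (simp_all add: mat_adjoint_def)

lemma mat_adjoint_carrier [simp, intro]:
  "A \<in> carrier_mat m k \<Longrightarrow> mat_adjoint A \<in> carrier_mat k m"
  by (metis carrier_matD carrier_matI dim_mat_adjoint)

lemma mat_adjoint_mult:
  fixes A B :: "complex mat"
  assumes "A \<in> carrier_mat m k" "B \<in> carrier_mat k l"
  shows "mat_adjoint (A * B) = mat_adjoint B * mat_adjoint A"
  using assms
  by (intro eq_matI) (auto simp: scalar_prod_def mult.commute intro!: sum.cong)

lemma mat_adjoint_adjoint [simp]: "mat_adjoint (mat_adjoint (A :: complex mat)) = A"
  by (intro eq_matI) auto

text \<open>Since \<open>\<bullet>c\<close> conjugates its second argument, the entries of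
  \<open>A\<close> appear conjugated on both sides, and the two expansions are the same double sum
  in opposite orders.\<close>

lemma cscalar_prod_adjoint:
  fixes A :: "complex mat"
  assumes "A \<in> carrier_mat m k" "v \<in> carrier_vec m" "w \<in> carrier_vec k"
  shows "(mat_adjoint A *\<^sub>v v) \<bullet>c w = v \<bullet>c (A *\<^sub>v w)"
proof -
  have "(mat_adjoint A *\<^sub>v v) \<bullet>c w
      = (\<Sum>i<k. \<Sum>j<m. cnj (A $$ (j, i)) * v $ j * cnj (w $ i))"
    using assms
    by (auto simp: scalar_prod_def atLeast0LessThan sum_distrib_right intro!: sum.cong)
  also have "\<dots> = (\<Sum>j<m. \<Sum>i<k. v $ j * (cnj (A $$ (j, i)) * cnj (w $ i)))"
    by (subst sum.swap) (simp add: mult_ac)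
  also have "\<dots> = v \<bullet>c (A *\<^sub>v w)"
    using assms
    by (auto simp: scalar_prod_def atLeast0LessThan sum_distrib_left intro!: sum.cong)
  finally show ?thesis .
qed

text \<open>The form at \<open>v\<close> equals the squared norm of \<open>A *\<^sub>v v\<close>,
  which injectivity keeps away from 0. This is the source of the positive definite
  counterexample.\<close>

lemma hermitian_positive_definite_adjoint_mult:
  assumes A: "A \<in> carrier_mat m k"
    and inj: "\<And>v. v \<in> carrier_vec k \<Longrightarrow> A *\<^sub>v v = 0\<^sub>v m \<Longrightarrow> v = 0\<^sub>v k"
  shows "hermitian_positive_definite k (mat_adjoint A * A)"
  unfolding hermitian_positive_definite_def hermitian_mat_def
proof (intro conjI ballI impI)
  show "mat_adjoint A * A \<in> carrier_mat k k"
    using A by auto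
  show "mat_adjoint (mat_adjoint A * A) = mat_adjoint A * A"
    using A by (simp add: mat_adjoint_mult[OF mat_adjoint_carrier])
  fix v :: "complex vec"
  assume v: "v \<in> carrier_vec k" "v \<noteq> 0\<^sub>v k"
  have Av: "A *\<^sub>v v \<in> carrier_vec m"
    using A v by simp
  have "(mat_adjoint A * A *\<^sub>v v) \<bullet>c v = (A *\<^sub>v v) \<bullet>c (A *\<^sub>v v)"
    using cscalar_prod_adjoint[OF A Av v(1)]
      assoc_mult_mat_vec[OF mat_adjoint_carrier[OF A] A v(1)] by simp
  moreover have "0 < (A *\<^sub>v v) \<bullet>c (A *\<^sub>v v)"
    using Av inj v by (subst conjugate_square_greater_0_vec) auto
  ultimately show "0 < (mat_adjoint A * A *\<^sub>v v) \<bullet>c v"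
    by simp
qed

lemma symplectic_unit_carrier [simp]:
  "symplectic_unit n \<in> carrier_mat (2 * n) (2 * n)"
  by (auto simp: symplectic_unit_def mult_2)

lemma dim_symplectic_unit [simp]:
  "dim_row (symplectic_unit n) = 2 * n" "dim_col (symplectic_unit n) = 2 * n"
  using carrier_matD[OF symplectic_unit_carrier] by auto

lemma symplectic_unit_mult_self:
  "symplectic_unit n * symplectic_unit n = - 1\<^sub>m (2 * n)"
  by (subst symplectic_unit_def, subst symplectic_unit_def,
      subst mult_four_block_mat[of _ n n _ n _ n _ _ n _ n])
    (auto simp: mult_2 intro!: eq_matI)

lemma mat_adjoint_symplectic_unit:
  "mat_adjoint (symplectic_unit n) = - symplectic_unit n"
  by (rule eq_matI) (auto simp: symplectic_unit_def)

text \<open>The defining identity exhibits a left inverse of \<open>S\<close>; for square matrices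
  it is also a right inverse, which moves the adjoint to the other side of \<open>J\<close>.\<close>

lemma symplectic_mat_mult_adjoint:
  assumes "symplectic_mat n S"
  shows "S * symplectic_unit n * mat_adjoint S = symplectic_unit n"
proof -
  let ?J = "symplectic_unit n" and ?N = "2 * n"
  have S: "S \<in> carrier_mat ?N ?N" and eq: "mat_adjoint S * ?J * S = ?J"
    using assms by (auto simp: symplectic_mat_def)
  have J: "?J \<in> carrier_mat ?N ?N" by simp
  have H: "mat_adjoint S \<in> carrier_mat ?N ?N" using S by auto
  \<comment> \<open>Chosen because \<open>J\<^sup>2 = -I\<close> turns
    \<open>S\<^sup>H J S = J\<close> into \<open>- J (S\<^sup>H J S) = I\<close>.\<close>
  define T where "T = - (?J * mat_adjoint S * ?J)"
  have T: "T \<in> carrier_mat ?N ?N" using J H by (simp add: T_def mult_carrier_mat[of _ ?N ?N _ ?N])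
  have "T * S = - (?J * (mat_adjoint S * ?J * S))"
    unfolding T_def using J H S
    by (simp add: assoc_mult_mat[of _ ?N ?N _ ?N _ ?N] mult_carrier_mat[of _ ?N ?N _ ?N])
  also have "\<dots> = 1\<^sub>m ?N"
    by (simp add: eq symplectic_unit_mult_self)
  finally have "S * T = 1\<^sub>m ?N"
    using mat_mult_left_right_inverse[OF T S] by simp
  hence *: "S * T * ?J = ?J"
    using J by simp
  \<comment> \<open>With \<open>J\<^sup>2 = -I\<close> the signs cancel and
    \<open>T J = J S\<^sup>H\<close>, so that \<open>S T J = J\<close> becomes the claim.\<close>
  have "T * ?J = - (?J * mat_adjoint S * (?J * ?J))"
    unfolding T_def using J H
    by (simp add: assoc_mult_mat[of _ ?N ?N _ ?N _ ?N] mult_carrier_mat[of _ ?N ?N _ ?N])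
  also have "\<dots> = ?J * mat_adjoint S"
    using carrier_matD[OF S] right_mult_one_mat[OF mult_carrier_mat[OF J H]]
    by (simp add: symplectic_unit_mult_self)
  finally show ?thesis
    using * J H S T by (simp add: assoc_mult_mat[of _ ?N ?N _ ?N _ ?N] mult_carrier_mat[of _ ?N ?N _ ?N])
qed

text \<open>Moving the last factor \<open>S\<close> to the front by cyclicity forms
  \<open>S J S\<^sup>H\<close>, which is \<open>J\<close>. The trace of \<open>J M\<close> is thus
  an invariant of symplectic congruence, the obstruction used below.\<close>

lemma mtrace_symplectic_unit_mult_congruence:
  assumes S: "symplectic_mat n S" and D: "D \<in> carrier_mat (2 * n) (2 * n)"
  shows "mtrace (symplectic_unit n * (mat_adjoint S * D * S)) = mtrace (symplectic_unit n * D)"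
proof -
  let ?J = "symplectic_unit n" and ?N = "2 * n"
  have J: "?J \<in> carrier_mat ?N ?N" by simp
  have S': "S \<in> carrier_mat ?N ?N" using S by (auto simp: symplectic_mat_def)
  have H: "mat_adjoint S \<in> carrier_mat ?N ?N" using S' by auto
  have "mtrace (?J * (mat_adjoint S * D * S)) = mtrace ((?J * mat_adjoint S * D) * S)"
    using J H S' D by (simp add: assoc_mult_mat[of _ ?N ?N _ ?N _ ?N] mult_carrier_mat[of _ ?N ?N _ ?N])
  also have "\<dots> = mtrace (S * (?J * mat_adjoint S * D))"
    by (rule mtrace_mult_commute[of _ ?N ?N]) (use J H S' D in \<open>auto intro!: mult_carrier_mat[of _ ?N ?N _ ?N]\<close>)
  also have "S * (?J * mat_adjoint S * D) = (S * ?J * mat_adjoint S) * D"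
    using J H S' D by (simp add: assoc_mult_mat[of _ ?N ?N _ ?N _ ?N] mult_carrier_mat[of _ ?N ?N _ ?N])
  finally show ?thesis
    by (simp add: symplectic_mat_mult_adjoint[OF S])
qed

lemma williamson_diag_carrier [simp]:
  "williamson_diag n l \<in> carrier_mat (2 * n) (2 * n)"
  by (auto simp: williamson_diag_def Let_def mult_2 mat_diag_def)

text \<open>Multiplying a block diagonal matrix by \<open>J\<close> moves its blocks off the
  diagonal, leaving zero diagonal blocks.\<close>

lemma mtrace_symplectic_unit_mult_williamson_diag:
  "mtrace (symplectic_unit n * williamson_diag n l) = 0"
proof -
  define L where "L = mat_diag n (\<lambda>i. complex_of_real (l i))"
  have L: "L \<in> carrier_mat n n" by (simp add: L_def mat_diag_def)
  have "symplectic_unit n * williamson_diag n l = four_block_mat (0\<^sub>m n n) L (- L) (0\<^sub>m n n)"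
    unfolding symplectic_unit_def williamson_diag_def Let_def L_def[symmetric]
    by (subst mult_four_block_mat[of _ n n _ n _ n _ _ n _ n]) (use L in auto)
  thus ?thesis
    by (simp add: mtrace_four_block[of _ n _ n]) (simp add: mtrace_def)
qed

lemma mtrace_symplectic_unit: "mtrace (symplectic_unit n) = 0"
  by (simp add: symplectic_unit_def mtrace_four_block[of _ n _ n]) (simp add: mtrace_def)

theorem proposition3p16:
  fixes n :: nat
  assumes "n \<ge> 1"
  shows "\<not> (\<forall>M. hermitian_positive_definite (2 * n) M \<longrightarrow>
            (\<exists>S l. symplectic_mat n S \<and> (\<forall>j<n. 0 < l j) \<and>
                   M = mat_adjoint S * williamson_diag n l * S))"
proof
  assume all: "\<forall>M. hermitian_positive_definite (2 * n) M \<longrightarrow>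
            (\<exists>S l. symplectic_mat n S \<and> (\<forall>j<n. 0 < l j) \<and>
                   M = mat_adjoint S * williamson_diag n l * S)"
  let ?J = "symplectic_unit n" and ?N = "2 * n"
  have J: "?J \<in> carrier_mat ?N ?N" by simp
  \<comment> \<open>For real \<open>t\<close>, the matrix \<open>I + t \<i> J\<close> is Hermitian
    with eigenvalues \<open>1 + t\<close> and \<open>1 - t\<close>, and its square has the
    \<open>J\<close>-component \<open>2 t \<i> J\<close>. So \<open>t\<close> must avoid 0, 1 and
    -1; here \<open>t = 2\<close>. \<open>B\<close> is the same matrix with \<open>t = -2\<close>,
    an inverse of \<open>A\<close> up to a scalar.\<close>
  define A B where "A = 1\<^sub>m ?N + (2 * \<i>) \<cdot>\<^sub>m ?J" and "B = 1\<^sub>m ?N + (- 2 * \<i>) \<cdot>\<^sub>m ?J"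
  have A: "A \<in> carrier_mat ?N ?N" and B: "B \<in> carrier_mat ?N ?N"
    using J by (auto simp: A_def B_def)
  \<comment> \<open>Since \<open>J\<^sup>2 = -I\<close>, combinations of \<open>I\<close> and
    \<open>J\<close> multiply as if \<open>J\<close> were an imaginary unit. This computes both
    \<open>B * A\<close> and \<open>A * A\<close>.\<close>
  have prod: "(1\<^sub>m ?N + c \<cdot>\<^sub>m ?J) * (1\<^sub>m ?N + d \<cdot>\<^sub>m ?J) = (1 - c * d) \<cdot>\<^sub>m 1\<^sub>m ?N + (c + d) \<cdot>\<^sub>m ?J"
    for c d
  proof -
    have "(1\<^sub>m ?N + c \<cdot>\<^sub>m ?J) * (1\<^sub>m ?N + d \<cdot>\<^sub>m ?J)
        = 1\<^sub>m ?N + d \<cdot>\<^sub>m ?J + (c \<cdot>\<^sub>m ?J + (c * d) \<cdot>\<^sub>m (?J * ?J))"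
      using J by (simp add: add_mult_distrib_mat[of _ ?N ?N _ _ ?N] mult_carrier_mat[of _ ?N ?N _ ?N]
          mult_add_distrib_mat[of _ ?N ?N _ ?N] mult_smult_distrib[of _ ?N ?N _ ?N]
          mult_smult_assoc_mat[of _ ?N ?N _ ?N] left_mult_one_mat[of _ ?N ?N]
          right_mult_one_mat[of _ ?N ?N])
        (rule eq_matI, auto simp: algebra_simps)
    also have "\<dots> = (1 - c * d) \<cdot>\<^sub>m 1\<^sub>m ?N + (c + d) \<cdot>\<^sub>m ?J"
      unfolding symplectic_unit_mult_self using J
      by (intro eq_matI) (auto simp: algebra_simps)
    finally show ?thesis .
  qed
  \<comment> \<open>Two signs cancel: \<open>J\<close> is skew-adjoint and the coefficient
    \<open>2 * \<i>\<close> is purely imaginary.\<close>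
  have adj: "mat_adjoint A = A"
  proof (rule eq_matI)
    fix i j assume ij: "i < dim_row A" "j < dim_col A"
    have "cnj (?J $$ (j, i)) = - ?J $$ (i, j)"
      using arg_cong[OF mat_adjoint_symplectic_unit[of n], of "\<lambda>X. X $$ (i, j)"] ij A J
      by simp
    then show "mat_adjoint A $$ (i, j) = A $$ (i, j)"
      using ij A J by (auto simp: A_def)
  qed (use A in auto)
  have BA: "B * A = (- 3) \<cdot>\<^sub>m 1\<^sub>m ?N"
    unfolding A_def B_def prod using J by (intro eq_matI) auto
  \<comment> \<open>Applying \<open>B\<close> to \<open>A *\<^sub>v v = 0\<close> leaves
    \<open>-3 v = 0\<close>.\<close>
  have "v = 0\<^sub>v ?N" if v: "v \<in> carrier_vec ?N" and Av: "A *\<^sub>v v = 0\<^sub>v ?N" for v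
  proof -
    have "(- 3) \<cdot>\<^sub>v v = (B * A) *\<^sub>v v"
      unfolding BA using v by (intro eq_vecI) auto
    also have "\<dots> = 0\<^sub>v ?N"
      using A B v Av by (auto simp: assoc_mult_mat_vec[of _ ?N ?N _ ?N] intro!: eq_vecI)
    finally have "(- 3) \<cdot>\<^sub>v v = 0\<^sub>v ?N" .
    hence "- 3 * v $ i = 0" if "i < ?N" for i
      using that v by (metis carrier_vecD index_smult_vec(1) index_zero_vec(1))
    thus ?thesis using v by (intro eq_vecI) auto
  qed
  then have "hermitian_positive_definite ?N (A * A)"
    using hermitian_positive_definite_adjoint_mult[OF A] adj by simp
  then obtain S l where S: "symplectic_mat n S"
    and eq: "A * A = mat_adjoint S * williamson_diag n l * S"
    using all by blast
  have "mtrace (?J * (A * A)) = 0"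
    unfolding eq by (simp add: mtrace_symplectic_unit_mult_congruence[OF S]
        mtrace_symplectic_unit_mult_williamson_diag)
  \<comment> \<open>By \<open>prod\<close>, \<open>A * A\<close> is \<open>5 I + 4 \<i> J\<close>,
    with \<open>5 = 1 - (2 \<i>)\<^sup>2\<close>; a further factor \<open>J\<close> exchanges the
    roles of the two terms.\<close>
  moreover have "?J * (A * A) = 5 \<cdot>\<^sub>m ?J + (- 4 * \<i>) \<cdot>\<^sub>m 1\<^sub>m ?N"
  proof -
    have "?J * (A * A) = 5 \<cdot>\<^sub>m ?J + (4 * \<i>) \<cdot>\<^sub>m (?J * ?J)"
      unfolding A_def prod using J
      by (simp add: mult_add_distrib_mat[of _ ?N ?N _ ?N] mult_smult_distrib[of _ ?N ?N _ ?N])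
    thus ?thesis
      unfolding symplectic_unit_mult_self using J by (auto intro!: eq_matI)
  qed
  \<comment> \<open>The identity has size \<open>2 * n\<close>, whence \<open>-4 \<i>\<close>
    contributes \<open>-8 \<i> n\<close>. As \<open>J\<close> has trace 0 and
    \<open>n \<ge> 1\<close>, the total is nonzero.\<close>
  moreover have "mtrace (5 \<cdot>\<^sub>m ?J + (- 4 * \<i>) \<cdot>\<^sub>m 1\<^sub>m ?N) = 5 * mtrace ?J - 8 * \<i> * of_nat n"
    using J by (simp add: mtrace_def sum.distrib sum_subtractf sum_distrib_left)
  ultimately show False
    using assms by (simp add: mtrace_symplectic_unit)
qed

end
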